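(* Let $n\geq 2$. The primary facet-defining inequalities of the partial order polytope $\mathrm{P}_{\mathrm{PO}}^{n}$ are exactly the following inequalities: $$-x_{ij}\leq 0,$$ $$x_{ij}+x_{ji}\leq 1,$$ $$x_{ij}+x_{jk}-x_{ik}\leq 1,$$ $$x_{ij}+x_{jk}+x_{ki}-x_{ji}-x_{kj}-x_{ik}\leq 1,$$ where $i,j,k$ are pairwise distinct elements of $[n]$ (those occurring in the respective inequality).
   Context: $[n]=\{1,\dots,n\}$ and $A_n=\{(i,j) : i,j\in[n],\ i\neq j\}$. We write $x_{ij}$ for the coordinate $x_{(i,j)}$ of $x\in\mathbb{R}^{A_n}$. A (strict) partial order on $[n]$ is an irreflexive, asymmetric, transitive relation $R\subseteq A_n$. The characteristic vector $\chi^R\in\mathbb{R}^{A_n}$ of $R$ has $\chi^R_{ij}=1$ if $(i,j)\in R$ and $0$ otherwise. The partial order polytope is $\mathrm{P}_{\mathrm{PO}}^{n}=\operatorname{conv}\{\chi^R : R \text{ a partial order on } [n]\}\subseteq\mathbb{R}^{A_n}$; it has full dimension $n(n-1)$. A linear inequality is valid for a polytope $P$ if all points of $P$ satisfy it; it is facet-defining if it is valid and the set of points of $P$ satisfying it with equality is a face of dimension $\dim(P)-1$. A linear inequality on $\mathbb{R}^{A_n}$ is primary when its coefficients, including the independent term, take only the values $-1,0,1$, i.e. when it has the form $\sum_{a\in A}x_a-\sum_{b\in B}x_b\leq\beta$ with $\beta\in\{-1,0,1\}$ and $A,B$ disjoint subsets of $A_n$, not both empty. *)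

theory Defs
  imports "HOL-Analysis.Analysis" "HOL-Library.Numeral_Type"
begin

text \<open>
  The ground set \<open>[n]\<close> is the universe of an arbitrary type \<open>'n\<close> of class \<^class>\<open>card2\<close>, that
  is, a finite type with \<open>n = CARD('n) \<ge> 2\<close> elements. The type \<open>'n arc\<close> is \<open>A\<^sub>n\<close>, so that
  \<open>real ^ 'n arc\<close> is the space of real vectors indexed by \<open>A\<^sub>n\<close>. The bound \<open>n \<ge> 2\<close> is what
  makes this type nonempty.
\<close>

typedef 'n arc = "{(i, j). i \<noteq> (j :: 'n :: card2)}"
  morphisms arc_pair Arc
proof -
  have "\<not> is_singleton (UNIV :: 'n set)"
    using two_le_card [where 'a = 'n] by (auto simp: is_singleton_altdef)
  then obtain i j :: 'n where "i \<noteq> j"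
    by (metis UNIV_I UNIV_eq_I is_singletonI' empty_iff)
  then show ?thesis by auto
qed

instance arc :: (card2) finite
proof
  have "inj (arc_pair :: 'a arc \<Rightarrow> 'a \<times> 'a)"
    by (simp add: inj_def arc_pair_inject)
  then show "finite (UNIV :: 'a arc set)"
    by (rule finite_imageD [rotated]) simp
qed

definition partial_order_rel :: "('n \<times> 'n) set \<Rightarrow> bool" where
  "partial_order_rel R \<longleftrightarrow> irrefl R \<and> asym R \<and> trans R"

definition char_vec :: "('n :: card2 \<times> 'n) set \<Rightarrow> real ^ 'n arc" where
  "char_vec R = (\<chi> a. if arc_pair a \<in> R then 1 else 0)"

definition partial_order_polytope :: "(real ^ 'n :: card2 arc) set" where
  "partial_order_polytope = convex hull {char_vec R | R. partial_order_rel R}"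

text \<open>
  A linear inequality is a pair \<open>(c, \<beta>)\<close> of coefficient vector and independent term, standing
  for \<open>c \<bullet> x \<le> \<beta>\<close>.
\<close>

definition valid_ineq :: "'a :: euclidean_space set \<Rightarrow> 'a \<times> real \<Rightarrow> bool" where
  "valid_ineq P = (\<lambda>(c, \<beta>). \<forall>x\<in>P. c \<bullet> x \<le> \<beta>)"

definition facet_defining :: "'a :: euclidean_space set \<Rightarrow> 'a \<times> real \<Rightarrow> bool" where
  "facet_defining P = (\<lambda>(c, \<beta>). valid_ineq P (c, \<beta>) \<and> {x \<in> P. c \<bullet> x = \<beta>} facet_of P)"

definition primary :: "(real ^ 'n :: card2 arc) \<times> real \<Rightarrow> bool" where
  "primary = (\<lambda>(c, \<beta>). \<beta> \<in> {-1, 0, 1} \<and>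
     (\<exists>A B. A \<inter> B = {} \<and> A \<union> B \<noteq> {} \<and>
        (\<forall>x. c \<bullet> x = (\<Sum>a\<in>A. x $ a) - (\<Sum>b\<in>B. x $ b))))"

text \<open>
  Coefficient vector of the linear form \<open>x \<mapsto> x\<^sub>i\<^sub>j\<close>; meaningful only for \<open>i \<noteq> j\<close>.
\<close>

definition X :: "'n :: card2 \<Rightarrow> 'n \<Rightarrow> real ^ 'n arc" where
  "X i j = axis (Arc (i, j)) 1"

lemma X_inner: "X i j \<bullet> x = x $ Arc (i, j)"
  by (simp add: X_def inner_axis')

end

theory Submission imports Defs begin

text \<open>
  The polytope is full-dimensional, so a facet determines its hyperplane. This has two uses.

  A valid inequality defines a facet as soon as every linear functional that is constant on its
  tight points is a multiple of its coefficient vector (\<open>facet_definingI\<close>). For the four families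
  this is read off from very small posets. If a coefficient \<open>c\<^sub>i\<^sub>j\<close> equals the right-hand side \<open>1\<close>,
  then \<open>{ij}\<close> is tight, and if \<open>c\<^sub>p\<^sub>q = 0\<close> and the two arcs are not consecutive, \<open>{ij, pq}\<close> is a
  tight poset as well; hence a functional constant on the tight points vanishes at \<open>pq\<close>. The
  chains \<open>{ij, jk, ik}\<close> fix the coefficients at the negative arcs, and settle the arc \<open>ki\<close> in the
  transitivity inequality, which is consecutive to both positive arcs.

  Conversely, consider a primary facet inequality with right-hand side \<open>\<beta>\<close> and coefficient vector
  \<open>c\<close>. The empty poset gives \<open>\<beta> \<ge> 0\<close>. If \<open>\<beta> = 0\<close>, the one-arc posets show that no coefficient is
  positive, so the inequality is a sum of inequalities \<open>- x\<^sub>i\<^sub>j \<le> 0\<close>, and a facet allows only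
  one summand. If \<open>\<beta> = 1\<close>, let \<open>A\<close> be the set of arcs with coefficient \<open>1\<close>. Two arcs
  that are not consecutive form a poset, so any two distinct arcs of \<open>A\<close> must be consecutive
  (\<open>positive_arcs_consecutive\<close>). This leaves for \<open>A\<close> only the subsets of a two-cycle, the paths
  \<open>{ij, jk}\<close> and the three-cycles. Whenever \<open>A\<close> contains a path \<open>ij\<close>, \<open>jk\<close>, the chain through
  \<open>i, j, k\<close> forces \<open>c\<^sub>i\<^sub>k = -1\<close> (\<open>positive_path_closed\<close>). In each case \<open>c\<close> is therefore bounded
  coefficientwise by one of the listed vectors \<open>c'\<close>. All points of the polytope are nonnegative,
  so \<open>c \<bullet> x \<le> 1\<close> is implied by \<open>c' \<bullet> x \<le> 1\<close>, and a facet inequality that is implied in this way is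
  equal to the implying one (\<open>facet_undominated\<close>).
\<close>

section \<open>Facets of full-dimensional convex sets\<close>

text \<open>
  If the face had too small a dimension, then adjoining the point \<open>p + c\<close>, which lies off its
  hyperplane, would still leave room for a hyperplane \<open>d \<bullet> x = \<gamma>\<close> through everything. Such a \<open>d\<close> is
  both a multiple of \<open>c\<close> and orthogonal to \<open>c\<close>.
\<close>

lemma facet_definingI:
  fixes P :: "'a :: euclidean_space set"
  assumes "convex P" and full: "aff_dim P = DIM('a)"
    and valid: "valid_ineq P (c, \<beta>)" and "c \<noteq> 0"
    and p: "p \<in> P" "c \<bullet> p = \<beta>"
    and multiple: "\<And>d \<gamma>. \<forall>x\<in>P. c \<bullet> x = \<beta> \<longrightarrow> d \<bullet> x = \<gamma> \<Longrightarrow> \<exists>t. d = t *\<^sub>R c"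
  shows "facet_defining P (c, \<beta>)"
proof -
  let ?F = "{x \<in> P. c \<bullet> x = \<beta>}"
  have "?F = P \<inter> {x. c \<bullet> x = \<beta>}" by auto
  then have face: "?F face_of P"
    using face_of_Int_supporting_hyperplane_le[OF \<open>convex P\<close>, of c \<beta>] valid
    by (auto simp: valid_ineq_def)
  have "aff_dim ?F \<le> aff_dim {x. c \<bullet> x = \<beta>}"
    by (rule aff_dim_subset) auto
  then have upper: "aff_dim ?F \<le> int DIM('a) - 1"
    using \<open>c \<noteq> 0\<close> by (simp add: aff_dim_hyperplane)
  have lower: "\<not> aff_dim ?F < int DIM('a) - 1"
  proof
    assume "aff_dim ?F < int DIM('a) - 1"
    then have "aff_dim (insert (p + c) ?F) < DIM('a)"
      by (auto simp: aff_dim_insert)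
    then obtain d \<gamma> where "d \<noteq> 0" and sub: "insert (p + c) ?F \<subseteq> {x. d \<bullet> x = \<gamma>}"
      by (rule aff_lowdim_subset_hyperplane)
    then obtain t where t: "d = t *\<^sub>R c"
      using multiple[of d \<gamma>] by auto
    have "d \<bullet> c = 0"
      using sub p by (auto simp: inner_add_right)
    then show False
      using t \<open>c \<noteq> 0\<close> \<open>d \<noteq> 0\<close> by auto
  qed
  have "?F facet_of P"
    unfolding facet_of_def using face upper lower full p by auto
  then show ?thesis
    using valid by (simp add: facet_defining_def)
qed

text \<open>
  A zero coefficient vector makes the tight set either empty or the whole of \<open>P\<close>; neither is a facet.
\<close>

lemma facet_defining_nonzero:
  assumes "facet_defining P (c, \<beta>)"
  shows "c \<noteq> 0"
proof
  assume "c = 0"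
  then have "{x \<in> P. c \<bullet> x = \<beta>} \<in> {P, {}}" by auto
  then show False using assms by (auto simp: facet_defining_def facet_of_def)
qed

text \<open>
  Every hyperplane containing a facet is the affine hull of that facet; so two hyperplanes through
  the same facet coincide.
\<close>

lemma affine_hull_facet:
  fixes P :: "'a :: euclidean_space set"
  assumes "F facet_of P" and full: "aff_dim P = DIM('a)"
    and "c \<noteq> 0" and sub: "F \<subseteq> {x. c \<bullet> x = \<beta>}"
  shows "affine hull F = {x. c \<bullet> x = \<beta>}"
proof (rule affine_dim_equal)
  show "affine hull F \<subseteq> {x. c \<bullet> x = \<beta>}"
    using sub by (simp add: hull_minimal affine_hyperplane)
  show "aff_dim (affine hull F) = aff_dim {x. c \<bullet> x = \<beta>}"
    using assms by (simp add: facet_of_def aff_dim_hyperplane)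
qed (use assms in \<open>auto simp: facet_of_def affine_hyperplane\<close>)

section \<open>Characteristic vectors of small posets\<close>

lemma arc_cases:
  fixes a :: "'n :: card2 arc"
  obtains p q where "p \<noteq> q" "a = Arc (p, q)"
proof (cases a)
  case (Arc y)
  then show ?thesis using that[of "fst y" "snd y"] by auto
qed

lemma Arc_eq_iff [simp]:
  "i \<noteq> j \<Longrightarrow> k \<noteq> l \<Longrightarrow> Arc (i, j) = Arc (k, l) \<longleftrightarrow> i = k \<and> j = l"
  by (simp add: Arc_inject)

lemma vec_arc_eqI:
  fixes c d :: "real ^ 'n :: card2 arc"
  assumes "\<And>p q. p \<noteq> q \<Longrightarrow> c $ Arc (p, q) = d $ Arc (p, q)"
  shows "c = d"
  unfolding vec_eq_iff using assms by (metis arc_cases)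

lemma X_nth [simp]:
  "i \<noteq> j \<Longrightarrow> p \<noteq> q \<Longrightarrow> X i j $ Arc (p, q) = (if i = p \<and> j = q then 1 else 0)"
  by (auto simp: X_def axis_def)

lemma inner_X: "c \<bullet> X i j = c $ Arc (i, j)"
  by (metis X_inner inner_commute)

lemma char_vec_nth [simp]:
  "p \<noteq> q \<Longrightarrow> char_vec R $ Arc (p, q) = (if (p, q) \<in> R then 1 else 0)"
  by (simp add: char_vec_def Arc_inverse)

lemma char_vec_empty [simp]: "char_vec {} = 0"
  by (simp add: char_vec_def vec_eq_iff)

lemma char_vec_insert:
  assumes "i \<noteq> j" "(i, j) \<notin> R"
  shows "char_vec (insert (i, j) R) = X i j + char_vec R"
  by (rule vec_arc_eqI) (use assms in auto)

lemma partial_order_rel_empty: "partial_order_rel {}"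
  by (simp add: partial_order_rel_def)

lemma partial_order_rel_arc: "i \<noteq> j \<Longrightarrow> partial_order_rel {(i, j)}"
  by (auto simp: partial_order_rel_def irrefl_def trans_def intro!: asymI)

lemma partial_order_rel_two_arcs:
  assumes "i \<noteq> j" "k \<noteq> l" "j \<noteq> k" "l \<noteq> i"
  shows "partial_order_rel {(i, j), (k, l)}"
  using assms by (auto simp: partial_order_rel_def irrefl_def trans_def intro!: asymI)

lemma partial_order_rel_chain:
  assumes "i \<noteq> j" "j \<noteq> k" "i \<noteq> k"
  shows "partial_order_rel {(i, j), (j, k), (i, k)}"
  using assms by (auto simp: partial_order_rel_def irrefl_def trans_def intro!: asymI)

section \<open>The partial order polytope\<close>

lemma char_vec_in_polytope: "partial_order_rel R \<Longrightarrow> char_vec R \<in> partial_order_polytope"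
  by (auto simp: partial_order_polytope_def intro!: hull_inc)

lemma zero_in_polytope: "0 \<in> partial_order_polytope"
  using char_vec_in_polytope[OF partial_order_rel_empty] by simp

lemma X_in_polytope: "i \<noteq> j \<Longrightarrow> X i j \<in> partial_order_polytope"
  using char_vec_in_polytope[OF partial_order_rel_arc, of i j] by (simp add: char_vec_insert)

lemma X_add_X_in_polytope:
  assumes "i \<noteq> j" "k \<noteq> l" "j \<noteq> k" "l \<noteq> i" "(i, j) \<noteq> (k, l)"
  shows "X i j + X k l \<in> partial_order_polytope"
  using char_vec_in_polytope[OF partial_order_rel_two_arcs[OF assms(1-4)]] assms
  by (auto simp: char_vec_insert)

lemma X_chain_in_polytope:
  assumes "i \<noteq> j" "j \<noteq> k" "i \<noteq> k"
  shows "X i j + X j k + X i k \<in> partial_order_polytope"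
  using char_vec_in_polytope[OF partial_order_rel_chain[OF assms]] assms
  by (simp add: char_vec_insert add.assoc)

lemma valid_polytopeI:
  assumes "\<And>R. partial_order_rel R \<Longrightarrow> c \<bullet> char_vec R \<le> \<beta>"
  shows "valid_ineq partial_order_polytope (c, \<beta>)"
proof -
  have "partial_order_polytope \<subseteq> {x. c \<bullet> x \<le> \<beta>}"
    unfolding partial_order_polytope_def
    by (rule hull_minimal) (use assms in \<open>auto simp: convex_halfspace_le\<close>)
  then show ?thesis by (auto simp: valid_ineq_def)
qed

text \<open>
  A hyperplane through the polytope would contain the origin and all unit vectors.
\<close>

lemma aff_dim_polytope:
  "aff_dim (partial_order_polytope :: (real ^ 'n :: card2 arc) set) = DIM(real ^ 'n arc)"
proof (rule ccontr)
  let ?P = "partial_order_polytope :: (real ^ 'n arc) set"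
  assume "aff_dim ?P \<noteq> DIM(real ^ 'n arc)"
  then have "aff_dim ?P < DIM(real ^ 'n arc)"
    using aff_dim_le_DIM[of ?P] by linarith
  then obtain d \<gamma> where "d \<noteq> 0" and d: "?P \<subseteq> {x. d \<bullet> x = \<gamma>}"
    by (rule aff_lowdim_subset_hyperplane)
  have "\<gamma> = 0" using d zero_in_polytope by auto
  then have "d $ Arc (p, q) = 0" if "p \<noteq> q" for p q
    using d X_in_polytope[OF that] by (auto simp: inner_X)
  then have "d = 0" by (intro vec_arc_eqI) auto
  then show False using \<open>d \<noteq> 0\<close> by simp
qed

text \<open>
  The criterion \<open>facet_definingI\<close> with proportionality of the functionals checked arc by arc.
\<close>

lemma polytope_facet_definingI:
  fixes c :: "real ^ 'n :: card2 arc"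
  assumes valid: "valid_ineq partial_order_polytope (c, \<beta>)" and "c \<noteq> 0"
    and p: "p \<in> partial_order_polytope" "c \<bullet> p = \<beta>"
    and multiple: "\<And>d \<gamma>. \<forall>x\<in>partial_order_polytope. c \<bullet> x = \<beta> \<longrightarrow> d \<bullet> x = \<gamma> \<Longrightarrow>
      \<exists>t. \<forall>p q. p \<noteq> q \<longrightarrow> d $ Arc (p, q) = t * c $ Arc (p, q)"
  shows "facet_defining partial_order_polytope (c, \<beta>)"
proof (rule facet_definingI[OF _ aff_dim_polytope valid \<open>c \<noteq> 0\<close> p])
  show "convex (partial_order_polytope :: (real ^ 'n arc) set)"
    by (simp add: partial_order_polytope_def)
  fix d \<gamma> assume "\<forall>x\<in>partial_order_polytope. c \<bullet> x = \<beta> \<longrightarrow> d \<bullet> x = \<gamma>"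
  then obtain t where "\<forall>p q. p \<noteq> q \<longrightarrow> d $ Arc (p, q) = t * c $ Arc (p, q)"
    using multiple by blast
  then show "\<exists>t. d = t *\<^sub>R c"
    by (intro exI[of _ t] vec_arc_eqI) simp
qed

section \<open>The four families define facets\<close>

lemma valid_nonneg: "i \<noteq> j \<Longrightarrow> valid_ineq partial_order_polytope (- X i j, 0)"
  by (rule valid_polytopeI) (simp add: X_inner)

lemma valid_two_cycle:
  assumes "i \<noteq> j"
  shows "valid_ineq partial_order_polytope (X i j + X j i, 1)"
  by (rule valid_polytopeI)
    (use assms in \<open>auto simp: inner_add_left X_inner partial_order_rel_def dest: asymD\<close>)

lemma valid_transitivity:
  assumes "i \<noteq> j" "j \<noteq> k" "i \<noteq> k"
  shows "valid_ineq partial_order_polytope (X i j + X j k - X i k, 1)"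
  by (rule valid_polytopeI)
    (use assms in \<open>auto simp: inner_add_left inner_diff_left X_inner partial_order_rel_def dest: transD\<close>)

lemma valid_three_cycle:
  assumes "i \<noteq> j" "j \<noteq> k" "i \<noteq> k"
  shows "valid_ineq partial_order_polytope (X i j + X j k + X k i - X j i - X k j - X i k, 1)"
proof (rule valid_polytopeI)
  fix R :: "('a \<times> 'a) set" assume R: "partial_order_rel R"
  have t: "(a, b) \<in> R \<Longrightarrow> (b, c) \<in> R \<Longrightarrow> (a, c) \<in> R" and s: "(a, b) \<in> R \<Longrightarrow> (b, a) \<notin> R" for a b c
    using R by (auto simp: partial_order_rel_def dest: transD asymD)
  show "(X i j + X j k + X k i - X j i - X k j - X i k) \<bullet> char_vec R \<le> 1"
    using assms t[of i j k] t[of j k i] t[of k i j] s[of i j] s[of j k] s[of k i]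
    by (auto simp: inner_add_left inner_diff_left X_inner)
qed

lemma facet_nonneg:
  assumes "i \<noteq> j"
  shows "facet_defining partial_order_polytope (- X i j, 0)"
proof (rule polytope_facet_definingI[OF valid_nonneg[OF assms] _ zero_in_polytope])
  have "(- X i j) $ Arc (i, j) \<noteq> 0" using assms by simp
  then show "- X i j \<noteq> 0" by (metis zero_index)
next
  fix d :: "real ^ 'a arc" and \<gamma>
  assume const: "\<forall>x\<in>partial_order_polytope. - X i j \<bullet> x = 0 \<longrightarrow> d \<bullet> x = \<gamma>"
  note tight = const[rule_format]
  have "\<gamma> = 0" using tight[OF zero_in_polytope] by simp
  then have "d $ Arc (p, q) = 0" if "p \<noteq> q" "(p, q) \<noteq> (i, j)" for p q
    using tight[OF X_in_polytope[OF that(1)]] that assms by (auto simp: inner_X)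
  then show "\<exists>t. \<forall>p q. p \<noteq> q \<longrightarrow> d $ Arc (p, q) = t * (- X i j) $ Arc (p, q)"
    using assms by (intro exI[of _ "- d $ Arc (i, j)"]) auto
qed simp

text \<open>
  Both \<open>{ij}\<close> and \<open>{ij, pq}\<close> are tight posets, and they differ only in the arc \<open>pq\<close>.
\<close>

lemma zero_if_not_consecutive:
  assumes const: "\<forall>x\<in>partial_order_polytope. c \<bullet> x = 1 \<longrightarrow> d \<bullet> x = \<gamma>"
    and ij: "i \<noteq> j" "c $ Arc (i, j) = 1" and pq: "p \<noteq> q" "c $ Arc (p, q) = 0"
    and not_consecutive: "j \<noteq> p" "q \<noteq> i"
  shows "d $ Arc (p, q) = 0"
proof -
  have "d \<bullet> X i j = \<gamma>" 
    using const[rule_format, OF X_in_polytope] ij by (simp add: inner_X)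
  moreover have "d \<bullet> (X i j + X p q) = \<gamma>"
    using ij pq not_consecutive by (intro const[rule_format] X_add_X_in_polytope) (auto simp: inner_X inner_add_right)
  ultimately show ?thesis by (simp add: inner_X inner_add_right)
qed

text \<open>
  An arc other than \<open>ij\<close> and \<open>ji\<close> cannot be consecutive to both of them.
\<close>

lemma facet_two_cycle:
  assumes ij: "i \<noteq> j"
  shows "facet_defining partial_order_polytope (X i j + X j i, 1)" (is "facet_defining _ (?c, 1)")
proof (rule polytope_facet_definingI[OF valid_two_cycle[OF assms] _ X_in_polytope[OF assms]])
  show c: "?c \<bullet> X i j = 1" using ij by (simp add: inner_X)
  then show "?c \<noteq> 0" by force
next
  fix d :: "real ^ 'a arc" and \<gamma>
  assume const: "\<forall>x\<in>partial_order_polytope. ?c \<bullet> x = 1 \<longrightarrow> d \<bullet> x = \<gamma>"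
  note tight = const[rule_format]
  have pos: "d $ Arc (i, j) = \<gamma>" "d $ Arc (j, i) = \<gamma>"
    using tight[OF X_in_polytope, of i j] tight[OF X_in_polytope, of j i] ij by (auto simp: inner_X)
  have off: "d $ Arc (p, q) = 0" if "p \<noteq> q" "(p, q) \<notin> {(i, j), (j, i)}" for p q
  proof (cases "j = p \<or> q = i")
    case True
    then show ?thesis
      using that ij by (intro zero_if_not_consecutive[OF const, of j i]) auto
  next
    case False
    then show ?thesis
      using that ij by (intro zero_if_not_consecutive[OF const, of i j]) auto
  qed
  show "\<exists>t. \<forall>p q. p \<noteq> q \<longrightarrow> d $ Arc (p, q) = t * ?c $ Arc (p, q)"
  proof (intro exI[of _ \<gamma>] allI impI)
    fix p q :: 'a assume "p \<noteq> q"
    then show "d $ Arc (p, q) = \<gamma> * ?c $ Arc (p, q)"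
      using ij pos off[of p q] by (cases "(p, q) \<in> {(i, j), (j, i)}") auto
  qed
qed

text \<open>
  Only \<open>ki\<close> is consecutive to both \<open>ij\<close> and \<open>jk\<close> without belonging to the inequality. It needs the
  tight chain \<open>{ki, ij, kj}\<close>, whose arc \<open>kj\<close> has already been shown to have coefficient \<open>0\<close>.
\<close>

lemma facet_transitivity:
  assumes ijk: "i \<noteq> j" "j \<noteq> k" "i \<noteq> k"
  shows "facet_defining partial_order_polytope (X i j + X j k - X i k, 1)"
    (is "facet_defining _ (?c, 1)")
proof (rule polytope_facet_definingI[OF valid_transitivity[OF assms] _ X_in_polytope[OF assms(1)]])
  show c: "?c \<bullet> X i j = 1" using ijk by (simp add: inner_X)
  then show "?c \<noteq> 0" by force
next
  fix d :: "real ^ 'a arc" and \<gamma>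
  assume const: "\<forall>x\<in>partial_order_polytope. ?c \<bullet> x = 1 \<longrightarrow> d \<bullet> x = \<gamma>"
  note tight = const[rule_format]
  have pos: "d $ Arc (i, j) = \<gamma>" "d $ Arc (j, k) = \<gamma>"
    using tight[OF X_in_polytope, of i j] tight[OF X_in_polytope, of j k] ijk by (auto simp: inner_X)
  have neg: "d $ Arc (i, k) = - \<gamma>"
    using tight[OF X_chain_in_polytope, of i j k] ijk pos by (auto simp: inner_X inner_add_right)
  have off: "d $ Arc (p, q) = 0"
    if "p \<noteq> q" "(p, q) \<notin> {(i, j), (j, k), (i, k), (k, i)}" for p q
  proof (cases "j = p \<or> q = i")
    case True
    then show ?thesis
      using that ijk by (intro zero_if_not_consecutive[OF const, of j k]) auto
  next
    case False
    then show ?thesis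
      using that ijk by (intro zero_if_not_consecutive[OF const, of i j]) auto
  qed
  have "d $ Arc (k, i) = 0"
    using tight[OF X_chain_in_polytope, of k i j] off[of k j] ijk pos
    by (auto simp: inner_X inner_add_right)
  with pos neg off show "\<exists>t. \<forall>p q. p \<noteq> q \<longrightarrow> d $ Arc (p, q) = t * ?c $ Arc (p, q)"
    using ijk by (intro exI[of _ \<gamma>]) auto
qed

text \<open>
  Here the arc \<open>ki\<close> is itself positive, so every arc outside the inequality is non-consecutive to
  \<open>ij\<close> or to \<open>jk\<close>; the three chains along the cycle give the negative coefficients.
\<close>

lemma facet_three_cycle:
  assumes ijk: "i \<noteq> j" "j \<noteq> k" "i \<noteq> k"
  shows "facet_defining partial_order_polytope
    (X i j + X j k + X k i - X j i - X k j - X i k, 1)" (is "facet_defining _ (?c, 1)")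
proof (rule polytope_facet_definingI[OF valid_three_cycle[OF assms] _ X_in_polytope[OF assms(1)]])
  show c: "?c \<bullet> X i j = 1" using ijk by (simp add: inner_X)
  then show "?c \<noteq> 0" by force
next
  fix d :: "real ^ 'a arc" and \<gamma>
  assume const: "\<forall>x\<in>partial_order_polytope. ?c \<bullet> x = 1 \<longrightarrow> d \<bullet> x = \<gamma>"
  note tight = const[rule_format]
  have pos: "d $ Arc (i, j) = \<gamma>" "d $ Arc (j, k) = \<gamma>" "d $ Arc (k, i) = \<gamma>"
    using tight[OF X_in_polytope, of i j] tight[OF X_in_polytope, of j k]
      tight[OF X_in_polytope, of k i] ijk by (auto simp: inner_X)
  have neg: "d $ Arc (i, k) = - \<gamma>" "d $ Arc (j, i) = - \<gamma>" "d $ Arc (k, j) = - \<gamma>"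
    using tight[OF X_chain_in_polytope, of i j k] tight[OF X_chain_in_polytope, of j k i]
      tight[OF X_chain_in_polytope, of k i j] ijk pos by (auto simp: inner_X inner_add_right)
  have off: "d $ Arc (p, q) = 0"
    if "p \<noteq> q" "(p, q) \<notin> {(i, j), (j, k), (k, i), (j, i), (k, j), (i, k)}" for p q
  proof (cases "j = p \<or> q = i")
    case True
    then show ?thesis
      using that ijk by (intro zero_if_not_consecutive[OF const, of j k]) auto
  next
    case False
    then show ?thesis
      using that ijk by (intro zero_if_not_consecutive[OF const, of i j]) auto
  qed
  from pos neg off show "\<exists>t. \<forall>p q. p \<noteq> q \<longrightarrow> d $ Arc (p, q) = t * ?c $ Arc (p, q)"
    using ijk by (intro exI[of _ \<gamma>]) auto
qed

section \<open>Primary facets\<close>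

text \<open>
  The disjoint sets \<open>A\<close> and \<open>B\<close> are recovered as the arcs with coefficient \<open>1\<close> and \<open>-1\<close>, so being
  primary is a condition on the individual coefficients.
\<close>

lemma primary_iff:
  "primary (c, \<beta>) \<longleftrightarrow>
    \<beta> \<in> {-1, 0, 1} \<and> c \<noteq> 0 \<and> (\<forall>p q. p \<noteq> q \<longrightarrow> c $ Arc (p, q) \<in> {-1, 0, 1})"
  (is "_ \<longleftrightarrow> ?rhs")
proof
  assume "primary (c, \<beta>)"
  then obtain A B where "\<beta> \<in> {-1, 0, 1}" and disj: "A \<inter> B = {}" and ne: "A \<union> B \<noteq> {}"
    and inner: "\<And>x. c \<bullet> x = (\<Sum>a\<in>A. x $ a) - (\<Sum>b\<in>B. x $ b)"
    unfolding primary_def by auto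
  have c: "c $ a = (if a \<in> A then 1 else 0) - (if a \<in> B then 1 else 0)" for a
    using inner[of "axis a 1"] by (simp add: inner_axis) (simp add: axis_def)
  obtain a where "a \<in> A \<union> B" using ne by auto
  then have "c $ a \<noteq> 0" using disj by (auto simp: c)
  then have "c \<noteq> 0" by auto
  then show ?rhs using \<open>\<beta> \<in> _\<close> by (auto simp: c)
next
  assume r: ?rhs
  then have c: "c $ a \<in> {-1, 0, 1}" for a by (metis arc_cases)
  define A B where "A = {a. c $ a = 1}" and "B = {a. c $ a = -1}"
  have "c \<bullet> x = (\<Sum>a\<in>A. x $ a) - (\<Sum>b\<in>B. x $ b)" for x
  proof -
    have "c \<bullet> x = (\<Sum>a\<in>UNIV. (if a \<in> A then x $ a else 0) - (if a \<in> B then x $ a else 0))"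
      unfolding inner_vec_def
    proof (rule sum.cong)
      fix a show "c $ a \<bullet> x $ a = (if a \<in> A then x $ a else 0) - (if a \<in> B then x $ a else 0)"
        using c[of a] by (auto simp: A_def B_def)
    qed simp
    then show ?thesis by (simp add: sum_subtractf sum.If_cases)
  qed
  moreover have "A \<inter> B = {}" by (auto simp: A_def B_def)
  moreover have "A \<union> B \<noteq> {}"
  proof
    assume "A \<union> B = {}"
    then have "c $ a = 0" for a using c[of a] by (auto simp: A_def B_def)
    then show False using r by (simp add: vec_eq_iff)
  qed
  ultimately have "\<exists>A B. A \<inter> B = {} \<and> A \<union> B \<noteq> {} \<and>
      (\<forall>x. c \<bullet> x = (\<Sum>a\<in>A. x $ a) - (\<Sum>b\<in>B. x $ b))" by blast
  then show "primary (c, \<beta>)" using r by (simp add: primary_def)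
qed

text \<open>
  Points of the polytope have nonnegative coordinates.
\<close>

lemma polytope_inner_mono:
  assumes x: "x \<in> partial_order_polytope"
    and le: "\<And>p q. p \<noteq> q \<Longrightarrow> c $ Arc (p, q) \<le> c' $ Arc (p, q)"
  shows "c \<bullet> x \<le> c' \<bullet> x"
proof -
  have "c $ a * x $ a \<le> c' $ a * x $ a" for a
  proof -
    obtain p q where pq: "p \<noteq> q" "a = Arc (p, q)" by (rule arc_cases)
    have "0 \<le> x $ a"
      using valid_nonneg[OF pq(1)] x pq by (auto simp: valid_ineq_def X_inner)
    then show ?thesis using le pq by (auto intro: mult_right_mono)
  qed
  then show ?thesis by (auto simp: inner_vec_def intro: sum_mono)
qed

text \<open>
  All points tight for \<open>c\<close> are tight for \<open>c'\<close>. If \<open>c \<noteq> c'\<close>, the facet would then lie both in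
  \<open>(c' - c) \<bullet> x = 0\<close> and in \<open>c \<bullet> x = 1\<close>, and these two hyperplanes would have to be equal.
\<close>

lemma facet_undominated:
  assumes facet: "facet_defining partial_order_polytope (c, 1)"
    and valid': "valid_ineq partial_order_polytope (c', 1)"
    and le: "\<And>p q. p \<noteq> q \<Longrightarrow> c $ Arc (p, q) \<le> c' $ Arc (p, q)"
  shows "c = c'"
proof (rule ccontr)
  assume "c \<noteq> c'"
  let ?F = "{x \<in> partial_order_polytope. c \<bullet> x = 1}"
  have F: "?F facet_of partial_order_polytope"
    using facet by (simp add: facet_defining_def)
  have "c' \<bullet> x = 1" if "x \<in> ?F" for x
    using polytope_inner_mono[of x c c'] le valid' that by (fastforce simp: valid_ineq_def)
  then have "?F \<subseteq> {x. (c' - c) \<bullet> x = 0}" by (auto simp: inner_diff_left)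
  then have "affine hull ?F = {x. (c' - c) \<bullet> x = 0}"
    using \<open>c \<noteq> c'\<close> by (intro affine_hull_facet[OF F aff_dim_polytope]) auto
  moreover have "affine hull ?F = {x. c \<bullet> x = 1}"
    using facet_defining_nonzero[OF facet] by (intro affine_hull_facet[OF F aff_dim_polytope]) auto
  \<comment> \<open>Two nonzero functionals cut out the same hyperplane, but only one of the two hyperplanes
    passes through the origin.\<close>
  ultimately have "0 \<in> {x. c \<bullet> x = 1}" by (metis (mono_tags) inner_zero_right mem_Collect_eq)
  then show False by simp
qed

text \<open>
  All coefficients are nonpositive. Choosing an arc \<open>ij\<close> with coefficient \<open>-1\<close>, every point of the
  facet satisfies \<open>x\<^sub>i\<^sub>j = 0\<close>, so this is the hyperplane of the facet; any other unit vector lies on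
  it, which makes the corresponding coefficient of \<open>c\<close> vanish.
\<close>

lemma primary_facet_0:
  assumes "primary (c, 0)" and facet: "facet_defining partial_order_polytope (c, 0)"
  shows "\<exists>i j. i \<noteq> j \<and> c = - X i j"
proof -
  let ?F = "{x \<in> partial_order_polytope. c \<bullet> x = 0}"
  have c: "c \<noteq> 0" "\<And>p q. p \<noteq> q \<Longrightarrow> c $ Arc (p, q) \<in> {-1, 0, 1}"
    using assms(1) by (auto simp: primary_iff)
  have valid: "\<And>x. x \<in> partial_order_polytope \<Longrightarrow> c \<bullet> x \<le> 0"
    and F: "?F facet_of partial_order_polytope"
    using facet by (auto simp: facet_defining_def valid_ineq_def)
  have nonpos: "c $ Arc (p, q) \<le> 0" if "p \<noteq> q" for p q
    using valid[OF X_in_polytope[OF that]] by (simp add: inner_X)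
  obtain i j where ij: "i \<noteq> j" "c $ Arc (i, j) \<noteq> 0"
    using c(1) vec_arc_eqI[of c 0] by auto
  then have "c $ Arc (i, j) = -1" using c(2)[of i j] nonpos[of i j] by auto
  then have le: "c $ Arc (p, q) \<le> (- X i j) $ Arc (p, q)" if "p \<noteq> q" for p q
    using that nonpos ij by auto
  have "- X i j \<bullet> x = 0" if "x \<in> ?F" for x
    using polytope_inner_mono[of x c "- X i j"] le valid_nonneg[OF ij(1)] that
    by (fastforce simp: valid_ineq_def)
  then have "?F \<subseteq> {x. X i j \<bullet> x = 0}" by auto
  moreover have "X i j \<noteq> 0" using X_nth[OF ij(1) ij(1)] by force
  ultimately have "affine hull ?F = {x. X i j \<bullet> x = 0}"
    by (intro affine_hull_facet[OF F aff_dim_polytope])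
  moreover have "affine hull ?F = {x. c \<bullet> x = 0}"
    using c(1) by (intro affine_hull_facet[OF F aff_dim_polytope]) auto
  ultimately have same: "X i j \<bullet> x = 0 \<longleftrightarrow> c \<bullet> x = 0" for x by blast
  have "c = - X i j"
  proof (rule vec_arc_eqI)
    fix p q :: 'a assume "p \<noteq> q"
    then show "c $ Arc (p, q) = (- X i j) $ Arc (p, q)"
      using same[of "X p q"] \<open>c $ Arc (i, j) = -1\<close> ij by (auto simp: inner_X split: if_splits)
  qed
  then show ?thesis using ij by blast
qed

text \<open>
  Otherwise the two arcs would form a poset at which the left-hand side is \<open>2\<close>.
\<close>

lemma positive_arcs_consecutive:
  assumes "valid_ineq partial_order_polytope (c, 1)"
    and "i \<noteq> j" "c $ Arc (i, j) = 1" "k \<noteq> l" "c $ Arc (k, l) = 1" "(i, j) \<noteq> (k, l)"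
  shows "j = k \<or> l = i"
proof (rule ccontr)
  assume "\<not> ?thesis"
  then have "c \<bullet> (X i j + X k l) \<le> 1"
    using assms X_add_X_in_polytope[of i j k l] by (auto simp: valid_ineq_def)
  then show False using assms by (simp add: inner_X inner_add_right)
qed

text \<open>
  On the chain \<open>{ij, jk, ik}\<close> the left-hand side is \<open>2 + c\<^sub>i\<^sub>k\<close>.
\<close>

lemma positive_path_closed:
  assumes valid: "valid_ineq partial_order_polytope (c, 1)"
    and range: "\<And>p q. p \<noteq> q \<Longrightarrow> c $ Arc (p, q) \<in> {-1, 0, 1}"
    and "i \<noteq> j" "j \<noteq> k" "i \<noteq> k" "c $ Arc (i, j) = 1" "c $ Arc (j, k) = 1"
  shows "c $ Arc (i, k) = -1"
proof -
  have "c \<bullet> (X i j + X j k + X i k) \<le> 1"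
    using valid X_chain_in_polytope[of i j k] assms by (auto simp: valid_ineq_def)
  then show ?thesis using assms range[of i k] by (auto simp: inner_X inner_add_right)
qed

text \<open>
  The positive arcs either contain a path \<open>ij\<close>, \<open>jk\<close> on three elements or lie in a single two-cycle.
  In the first case the only further positive arc that is consecutive to both is \<open>ki\<close>. In each
  case a listed inequality dominates.
\<close>

lemma primary_facet_1:
  fixes c :: "real ^ 'n :: card2 arc"
  assumes "primary (c, 1)" and facet: "facet_defining partial_order_polytope (c, 1)"
  shows "(\<exists>i j. i \<noteq> j \<and> c = X i j + X j i)
    \<or> (\<exists>i j k. i \<noteq> j \<and> j \<noteq> k \<and> i \<noteq> k \<and> c = X i j + X j k - X i k)
    \<or> (\<exists>i j k. i \<noteq> j \<and> j \<noteq> k \<and> i \<noteq> k \<and> c = X i j + X j k + X k i - X j i - X k j - X i k)"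
proof -
  have c: "\<And>p q. p \<noteq> q \<Longrightarrow> c $ Arc (p, q) \<in> {-1, 0, 1}"
    using assms(1) by (auto simp: primary_iff)
  have valid: "valid_ineq partial_order_polytope (c, 1)"
    using facet by (simp add: facet_defining_def)
  have le_1: "c $ Arc (p, q) \<le> 1" if "p \<noteq> q" for p q
    using c[OF that] by auto
  have le_0: "c $ Arc (p, q) \<le> 0" if "p \<noteq> q" "c $ Arc (p, q) \<noteq> 1" for p q
    using c[OF that(1)] that(2) by auto
  note consecutive = positive_arcs_consecutive[OF valid]
  note closed = positive_path_closed[OF valid c]
  note undominated = facet_undominated[OF facet]
  show ?thesis
  proof (cases "\<exists>i j k. i \<noteq> j \<and> j \<noteq> k \<and> i \<noteq> k \<and> c $ Arc (i, j) = 1 \<and> c $ Arc (j, k) = 1")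
    case True
    then obtain i j k where ijk: "i \<noteq> j" "j \<noteq> k" "i \<noteq> k"
      and pos: "c $ Arc (i, j) = 1" "c $ Arc (j, k) = 1" by blast
    have ik: "c $ Arc (i, k) = -1" using closed ijk pos by blast
    have off: "c $ Arc (p, q) \<le> 0" if "p \<noteq> q" "(p, q) \<notin> {(i, j), (j, k), (k, i)}" for p q
      using consecutive[of i j p q] consecutive[of j k p q] le_0[of p q] that ijk pos by auto
    show ?thesis
    proof (cases "c $ Arc (k, i) = 1")
      case True
      then have "c $ Arc (j, i) = -1" "c $ Arc (k, j) = -1"
        using closed[of j k i] closed[of k i j] ijk pos by auto
      then have "c = X i j + X j k + X k i - X j i - X k j - X i k"
        using ijk le_1 off ik
        by (intro undominated valid_three_cycle) auto
      then show ?thesis using ijk by blast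
    next
      case False
      then have "c = X i j + X j k - X i k"
        using ijk le_1 off ik le_0[of k i]
        by (intro undominated valid_transitivity) auto
      then show ?thesis using ijk by blast
    qed
  next
    case False
    then have no_path: "\<not> (c $ Arc (i, j) = 1 \<and> c $ Arc (j, k) = 1)"
      if "i \<noteq> j" "j \<noteq> k" "i \<noteq> k" for i j k
      using that by blast
    \<comment> \<open>Even with a single positive arc, or none, the inequality of a two-cycle containing the
      positive arcs dominates.\<close>
    have "\<exists>i j. i \<noteq> j \<and> (\<forall>p q. p \<noteq> q \<longrightarrow> c $ Arc (p, q) = 1 \<longrightarrow> (p, q) \<in> {(i, j), (j, i)})"
    proof (cases "\<exists>i j. i \<noteq> j \<and> c $ Arc (i, j) = 1")
      case True
      then obtain i j where ij: "i \<noteq> j" "c $ Arc (i, j) = 1" by blast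
      have "(p, q) \<in> {(i, j), (j, i)}" if "p \<noteq> q" "c $ Arc (p, q) = 1" for p q
        using consecutive[of i j p q] no_path[of i j q] no_path[of p i j] that ij by auto
      then show ?thesis using ij(1) by blast
    next
      case False
      obtain i j :: 'n where "i \<noteq> j" by (rule arc_cases[of "undefined :: 'n arc"])
      then show ?thesis using False by blast
    qed
    then obtain i j where ij: "i \<noteq> j"
      and only: "\<And>p q. p \<noteq> q \<Longrightarrow> c $ Arc (p, q) = 1 \<Longrightarrow> (p, q) \<in> {(i, j), (j, i)}" by blast
    have "c = X i j + X j i"
      using ij le_1 le_0 only by (intro undominated valid_two_cycle) fastforce+
    then show ?thesis using ij by blast
  qed
qed

theorem theorem6:
  "{I :: (real ^ 'n :: card2 arc) \<times> real. primary I \<and> facet_defining partial_order_polytope I} =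
     {(- X i j, 0) | i j. i \<noteq> j}
   \<union> {(X i j + X j i, 1) | i j. i \<noteq> j}
   \<union> {(X i j + X j k - X i k, 1) | i j k. i \<noteq> j \<and> j \<noteq> k \<and> i \<noteq> k}
   \<union> {(X i j + X j k + X k i - X j i - X k j - X i k, 1) | i j k. i \<noteq> j \<and> j \<noteq> k \<and> i \<noteq> k}"
  (is "?lhs = ?rhs")
proof
  show "?lhs \<subseteq> ?rhs"
  proof
    fix I assume "I \<in> ?lhs"
    then obtain c \<beta> where I: "I = (c, \<beta>)"
      and prim: "primary (c, \<beta>)" and facet: "facet_defining partial_order_polytope (c, \<beta>)"
      by (cases I) auto
    have "0 \<le> \<beta>"
      using facet zero_in_polytope by (fastforce simp: facet_defining_def valid_ineq_def)
    then consider "\<beta> = 0" | "\<beta> = 1" using prim by (auto simp: primary_iff)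
    then show "I \<in> ?rhs"
    proof cases
      case 1
      then show ?thesis using primary_facet_0[of c] prim facet I by auto
    next
      case 2
      then show ?thesis using primary_facet_1[of c] prim facet unfolding I 2
        by (simp only: Un_iff mem_Collect_eq prod.inject) blast
    qed
  qed
  have families: "primary (c, \<beta>) \<and> facet_defining partial_order_polytope (c, \<beta>)"
    if "facet_defining partial_order_polytope (c, \<beta>)" "\<beta> \<in> {-1, 0, 1}"
      "\<And>p q. p \<noteq> q \<Longrightarrow> c $ Arc (p, q) \<in> {-1, 0, 1}"
    for c :: "real ^ 'n arc" and \<beta>
    using that facet_defining_nonzero[OF that(1)] by (simp add: primary_iff)
  show "?rhs \<subseteq> ?lhs"
    apply (intro Un_least subsetI; clarify)
    subgoal by (rule families[OF facet_nonneg]) auto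
    subgoal by (rule families[OF facet_two_cycle]) auto
    subgoal by (rule families[OF facet_transitivity]) auto
    subgoal by (rule families[OF facet_three_cycle]) auto
    done
qed

end
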